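(* Let $m,n$ be integers with $m\ge 2$ and $n\ge 5$, let $i,j$ be nonnegative integers, and let $M=\{1,m,m^2,\ldots,m^{n-3},m^i,m^j\}$ with $|M|=n$. If $M$ splits a nontrivial finite abelian group $G$, then $\{i,j\}\equiv\{n-2,n-1\}\pmod n$.
   Context: Let $G$ be a finite abelian group, written additively, and let $M$ be a set of integers. We say that $M$ splits $G$ if there is a subset $S\subseteq G$ such that every nonzero element $g\in G$ has a unique representation $g=ms$ with $m\in M$, $s\in S$, while $0$ has no such representation (here $ms$ is the usual integer multiple of $s$). For sets of integers $X,Y$, $X\equiv Y\pmod n$ means that $X$ and $Y$ have the same set of residues modulo $n$. *)

theory Defs
  imports "HOL-Algebra.Group"
begin

text \<open>
  Abelian groups are the multiplicatively written groups of HOL-Algebra, so the integer multiple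
  \<open>m s\<close> of the additive notation is \<open>s [^]\<^bsub>G\<^esub> m\<close>, and \<open>0\<close> is \<open>\<one>\<^bsub>G\<^esub>\<close>.
\<close>

definition set_splits_group :: "int set \<Rightarrow> ('a, 'b) monoid_scheme \<Rightarrow> bool" where
  "set_splits_group M G \<longleftrightarrow>
     (\<exists>S \<subseteq> carrier G.
        (\<forall>g \<in> carrier G - {\<one>\<^bsub>G\<^esub>}. \<exists>!p. p \<in> M \<times> S \<and> g = snd p [^]\<^bsub>G\<^esub> fst p) \<and>
        \<not> (\<exists>m \<in> M. \<exists>s \<in> S. \<one>\<^bsub>G\<^esub> = s [^]\<^bsub>G\<^esub> m))"

definition set_cong :: "int set \<Rightarrow> int set \<Rightarrow> int \<Rightarrow> bool" where
  "set_cong X Y n \<longleftrightarrow> (\<lambda>x. x mod n) ` X = (\<lambda>y. y mod n) ` Y"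

end

theory Submission
  imports Defs
begin

text \<open>
  Multiplication by \<open>m\<close> is injective on \<open>G\<close>: otherwise an element \<open>y\<close> that needs the largest
  possible number of multiplications by \<open>m\<close> to reach \<open>0\<close> must lie in the splitting set \<open>S\<close>, and
  so must \<open>y + x\<close> for every \<open>x\<close> in the kernel, although \<open>m y = m (y + x)\<close>.

  Hence \<open>m\<close> permutes \<open>X = G - {0}\<close>. No three consecutive points of an orbit avoid the translates
  \<open>S, m S, \<dots>, m\<^bsup>n-3\<^esup> S\<close>, since two of them would lie in the same translate \<open>m\<^sup>i S\<close> or \<open>m\<^sup>j S\<close>, whose
  points are at least \<open>n - 2 \<ge> 3\<close> apart. So the translates \<open>m\<^sup>k S\<close> with \<open>k < n\<close> cover \<open>X\<close>, and they
  tile it because \<open>|X| = n |S|\<close>. Therefore \<open>S\<close> is invariant under \<open>m\<^sup>n\<close>, which forces the exponents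
  in \<open>M\<close> to be distinct modulo \<open>n\<close>.
\<close>

text \<open>Combinatorial core, free of the group: only a permutation \<open>f\<close> of a finite
  set and a tiling by iterates of \<open>f\<close> remain. \<open>L \<ge> 3\<close> puts the
  exponents 0, 1, 2 into \<open>A\<close>, so points of \<open>S\<close> on one orbit cannot be one
  or two steps apart.\<close>

lemma permutation_tiling_distinct_mod:
  fixes f :: "'a \<Rightarrow> 'a" and L i j :: nat
  defines "A \<equiv> {..<L} \<union> {i, j}"
  assumes fin: "finite X" and ne: "X \<noteq> {}" and f: "bij_betw f X X" and SX: "S \<subseteq> X"
    and tile: "bij_betw (\<lambda>(a, s). (f ^^ a) s) (A \<times> S) X"
    and L: "L \<ge> 3" and card: "card A = L + 2"
  shows "inj_on (\<lambda>a. a mod (L + 2)) A"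
proof -
  let ?n = "L + 2"
  have funpow: "bij_betw (f ^^ k) X X" for k
    using f by (rule bij_betw_funpow)
  have inX: "(f ^^ k) x \<in> X" if "x \<in> X" for k x
    using funpow[of k] that by (auto simp: bij_betw_def)
  have cancel: "x = y" if "(f ^^ k) x = (f ^^ k) y" "x \<in> X" "y \<in> X" for k x y
    using funpow[of k] that by (auto simp: bij_betw_def inj_on_def)
  have uniq: "a = b \<and> s = t"
    if "(f ^^ a) s = (f ^^ b) t" "a \<in> A" "b \<in> A" "s \<in> S" "t \<in> S" for a b s t
    using tile that by (auto simp: bij_betw_def inj_on_def)
  have ex: "\<exists>a\<in>A. \<exists>s\<in>S. (f ^^ a) s = x" if "x \<in> X" for x
    using tile that by (fastforce simp: bij_betw_def)
  have finS: "finite S"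
    using SX fin by (rule finite_subset)
  have no_close: False
    if "(f ^^ (c + b)) s = (f ^^ (c' + b)) t" "c < c'" "c' \<le> 2" "s \<in> S" "t \<in> S" for b c c' s t
  proof -
    have "(f ^^ (c + b)) s = (f ^^ (c + b)) ((f ^^ (c' - c)) t)"
      using that funpow_add[of "c + b" "c' - c" f] by (simp add: add.commute)
    then have "s = (f ^^ (c' - c)) t"
      using that(4,5) SX inX by (elim cancel) blast+
    then have "(f ^^ 0) s = (f ^^ (c' - c)) t"
      by simp
    moreover have "0 \<in> A" "c' - c \<in> A"
      using that(2,3) L by (auto simp: A_def)
    ultimately have "0 = c' - c"
      using uniq[of 0 s "c' - c" t] that(4,5) by blast
    with that(2) show False by simp
  qed
  have covers: "\<exists>k<?n. \<exists>s\<in>S. (f ^^ k) s = x" if x: "x \<in> X" for x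
  proof -
    have "\<exists>y\<in>X. (f ^^ c) y = x" for c
      using bij_betw_imp_surj_on[OF funpow[of c]] x by (metis imageE)
    \<comment> \<open>\<open>y c\<close> is the point \<open>c\<close> steps before
      \<open>x\<close>, and \<open>a c\<close> will be the exponent of the tile containing it. Only
      \<open>c = 0, 1, 2\<close> matter.\<close>
    then obtain y where y: "y c \<in> X" "(f ^^ c) (y c) = x" for c
      by metis
    obtain a s where as: "a c \<in> A" "s c \<in> S" "(f ^^ a c) (s c) = y c" for c
      using ex[OF y(1)] by metis
    have x_eq: "(f ^^ (c + a c)) (s c) = x" for c
      using as(3)[of c] y(2)[of c] by (simp add: funpow_add)
    have "a 0 \<noteq> a 1" if "a 0 \<ge> L" "a 1 \<ge> L"
      using no_close[of 0 "a 0" "s 0" 1 "s 1"] x_eq[of 0] x_eq[of 1] as by auto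
    moreover have "a 0 \<noteq> a 2"
      using no_close[of 0 "a 0" "s 0" 2 "s 2"] x_eq[of 0] x_eq[of 2] as by auto
    moreover have "a 1 \<noteq> a 2"
      using no_close[of 1 "a 1" "s 1" 2 "s 2"] x_eq[of 1] x_eq[of 2] as by auto
    \<comment> \<open>Otherwise three pairwise distinct exponents would lie in
      \<open>{i, j}\<close>. With \<open>c \<le> 2\<close> and \<open>a c < L\<close>, the exponent
      \<open>c + a c\<close> reaching \<open>x\<close> is at most \<open>L + 1\<close>.\<close>
    ultimately have "a 0 < L \<or> a 1 < L \<or> a 2 < L"
      using as(1)[of 0] as(1)[of 1] as(1)[of 2] by (auto simp: A_def)
    then obtain c where "c \<le> 2" "a c < L"
      by (metis le_refl one_le_numeral zero_le)
    then show ?thesis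
      using x_eq[of c] as(2)[of c] by (intro exI[of _ "c + a c"]) auto
  qed
  have "card X = ?n * card S"
    using bij_betw_same_card[OF tile] card by (simp add: card_cartesian_product)
  moreover have "(\<lambda>(k, s). (f ^^ k) s) ` ({..<?n} \<times> S) = X"
    using covers inX SX by fastforce
  \<comment> \<open>A surjection between finite sets of equal size is injective.\<close>
  ultimately have inj: "inj_on (\<lambda>(k, s). (f ^^ k) s) ({..<?n} \<times> S)"
    using finS by (intro eq_card_imp_inj_on) (auto simp: card_cartesian_product)
  have step: "(f ^^ ?n) s \<in> S" if s: "s \<in> S" for s
  proof -
    obtain k t where kt: "k < ?n" "t \<in> S" "(f ^^ k) t = (f ^^ ?n) s"
      using covers[OF inX] s SX by blast
    show ?thesis
    proof (cases k)
      case 0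
      with kt show ?thesis by simp
    next
      \<comment> \<open>Cancelling one \<open>f\<close> brings the exponent \<open>?n\<close> down
        to \<open>L + 1\<close>, inside the range of \<open>inj\<close>. This forces
        \<open>k = ?n\<close>, against \<open>k < ?n\<close>.\<close>
      case (Suc l)
      have "(f ^^ 1) ((f ^^ l) t) = (f ^^ 1) ((f ^^ (L + 1)) s)"
        using kt(3) Suc by simp
      then have "(f ^^ l) t = (f ^^ (L + 1)) s"
        using s kt(2) SX inX by (elim cancel) blast+
      then have "(l, t) = (L + 1, s)"
        using kt s Suc inj_onD[OF inj, of "(l, t)" "(L + 1, s)"] by auto
      with kt(1) Suc show ?thesis by simp
    qed
  qed
  have steps: "(f ^^ (?n * q)) s \<in> S" if "s \<in> S" for q s
  proof (induction q)
    case (Suc q)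
    have "(f ^^ (?n * Suc q)) s = (f ^^ ?n) ((f ^^ (?n * q)) s)"
      by (simp only: mult_Suc_right funpow_add o_apply)
    with step[OF Suc] show ?case by simp
  qed (use that in simp)
  obtain s where s: "s \<in> S"
    using ne ex by blast
  have "a = b" if ab: "a \<in> A" "b \<in> A" "a mod ?n = b mod ?n" "a \<le> b" for a b
  proof -
    have "?n dvd b - a"
      using ab(3,4) by (metis mod_eq_dvd_iff_nat)
    then obtain q where "b = a + ?n * q"
      using ab(4) by (metis dvdE le_add_diff_inverse)
    then have "(f ^^ b) s = (f ^^ a) ((f ^^ (?n * q)) s)"
      by (simp only: funpow_add o_apply)
    then show ?thesis
      using uniq[OF _ ab(2,1) s steps[OF s]] by blast
  qed
  then show ?thesis
    by (intro inj_onI) (metis nat_le_linear)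
qed

text \<open>Extremal argument on the number of \<open>m\<close>-th powers needed to reach the
  identity: elements where this number is maximal cannot be proper multiples of elements of
  \<open>S\<close>, and a kernel element can be multiplied into them unnoticed.\<close>

lemma splitting_imp_kernel_trivial:
  fixes G :: "('a, 'b) monoid_scheme" and m :: int
  assumes "comm_group G" and fin: "finite (carrier G)"
    and SG: "S \<subseteq> carrier G"
    and ex: "\<And>g. g \<in> carrier G - {\<one>\<^bsub>G\<^esub>} \<Longrightarrow> \<exists>a\<in>A. \<exists>s\<in>S. g = s [^]\<^bsub>G\<^esub> (m ^ a)"
    and inj: "inj_on (\<lambda>s. s [^]\<^bsub>G\<^esub> m) S"
    and nz: "\<And>s. s \<in> S \<Longrightarrow> s [^]\<^bsub>G\<^esub> m \<noteq> \<one>\<^bsub>G\<^esub>"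
    and x: "x \<in> carrier G" "x [^]\<^bsub>G\<^esub> m = \<one>\<^bsub>G\<^esub>"
  shows "x = \<one>\<^bsub>G\<^esub>"
proof (rule ccontr)
  interpret comm_group G by fact
  assume x1: "x \<noteq> \<one>\<^bsub>G\<^esub>"
  \<comment> \<open>Height \<open>h\<close> means that exactly \<open>h + 1\<close> applications of
    the \<open>m\<close>-th power reach the identity; the identity itself has no height.\<close>
  define height where
    "height h y \<longleftrightarrow> y \<in> carrier G \<and> y [^]\<^bsub>G\<^esub> (m ^ h) \<noteq> \<one>\<^bsub>G\<^esub> \<and> y [^]\<^bsub>G\<^esub> (m ^ Suc h) = \<one>\<^bsub>G\<^esub>" for h y
  have trivial_mono: "y [^]\<^bsub>G\<^esub> (m ^ l) = \<one>\<^bsub>G\<^esub>"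
    if "y [^]\<^bsub>G\<^esub> (m ^ k) = \<one>\<^bsub>G\<^esub>" "k \<le> l" "y \<in> carrier G" for y k l
  proof -
    have "m ^ l = m ^ k * m ^ (l - k)"
      using that(2) by (simp flip: power_add)
    then have "y [^]\<^bsub>G\<^esub> (m ^ l) = (y [^]\<^bsub>G\<^esub> (m ^ k)) [^]\<^bsub>G\<^esub> (m ^ (l - k))"
      using that(3) by (simp only: int_pow_pow)
    with that(1) show ?thesis by simp
  qed
  have height_unique: "h = h'" if "height h y" "height h' y" for h h' y
    using that trivial_mono[of y "Suc h" h'] trivial_mono[of y "Suc h'" h]
    unfolding height_def by (meson not_less_eq_eq linorder_le_less_linear order.antisym Suc_leI)
  let ?Q = "{h. \<exists>y. height h y}"
  have "?Q \<subseteq> (\<lambda>y. THE h. height h y) ` carrier G"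
  proof
    fix h assume "h \<in> ?Q"
    then obtain y where y: "height h y" by blast
    then have "(THE h. height h y) = h"
      using height_unique by blast
    with y show "h \<in> (\<lambda>y. THE h. height h y) ` carrier G"
      unfolding height_def by blast
  qed
  then have finQ: "finite ?Q"
    using fin finite_surj by blast
  have "height 0 x"
    using x x1 by (simp add: height_def)
  then have "?Q \<noteq> {}" by blast
  define H where "H = Max ?Q"
  obtain y where y: "height H y"
    using Max_in[OF finQ \<open>?Q \<noteq> {}\<close>] unfolding H_def by blast
  have top_in_S: "z \<in> S" if z: "height H z" for z
  proof -
    have "z \<noteq> \<one>\<^bsub>G\<^esub>" "z \<in> carrier G"
      using z by (auto simp: height_def)
    then obtain a s where as: "a \<in> A" "s \<in> S" "z = s [^]\<^bsub>G\<^esub> (m ^ a)"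
      using ex[of z] by blast
    then have "s \<in> carrier G"
      using SG by blast
    then have "height (a + H) s"
      using z as(3) unfolding height_def by (simp add: int_pow_pow power_add mult_ac)
    \<comment> \<open>Maximality of \<open>H\<close> forces \<open>a = 0\<close>, so
      \<open>z = s\<close>.\<close>
    then have "a + H \<le> H"
      unfolding H_def by (intro Max_ge[OF finQ]) blast
    with as \<open>s \<in> carrier G\<close> show ?thesis by simp
  qed
  have "y \<in> S"
    using y by (rule top_in_S)
  \<comment> \<open>Height 0 would make the \<open>m\<close>-th power of \<open>y\<close> trivial,
    which \<open>nz\<close> forbids on \<open>S\<close>. Positivity of \<open>H\<close> lets
    \<open>shift\<close> apply to both exponents in \<open>height H\<close>.\<close>
  obtain h where h: "H = Suc h"
    using y nz[OF \<open>y \<in> S\<close>] by (cases H) (auto simp: height_def)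
  have yG: "y \<in> carrier G"
    using y by (simp add: height_def)
  have shift: "(y \<otimes>\<^bsub>G\<^esub> x) [^]\<^bsub>G\<^esub> (m ^ Suc k) = y [^]\<^bsub>G\<^esub> (m ^ Suc k)" for k
    using trivial_mono[of x 1 "Suc k"] x yG by (simp add: int_pow_mult_distrib m_comm)
  have "y \<otimes>\<^bsub>G\<^esub> x \<in> S"
  proof (rule top_in_S)
    show "height H (y \<otimes>\<^bsub>G\<^esub> x)"
      using y x(1) yG shift[of h] shift[of "Suc h"] unfolding height_def h by simp
  qed
  then have "y \<otimes>\<^bsub>G\<^esub> x = y"
    using inj_onD[OF inj] shift[of 0] \<open>y \<in> S\<close> by simp
  with x x1 yG show False
    by simp
qed

theorem corollary11:
  fixes G :: "('a, 'b) monoid_scheme"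
    and m :: int and n i j :: nat and M :: "int set"
  assumes "m \<ge> 2" and "n \<ge> 5"
    and "M = {m ^ k | k. k \<le> n - 3} \<union> {m ^ i, m ^ j}"
    and "card M = n"
    and "comm_group G" and "finite (carrier G)" and "carrier G \<noteq> {\<one>\<^bsub>G\<^esub>}"
    and "set_splits_group M G"
  shows "set_cong {int i, int j} {int n - 2, int n - 1} (int n)"
proof -
  interpret comm_group G by fact
  \<comment> \<open>The consecutive exponents 0 to \<open>n - 3\<close> are then exactly
    \<open>{..<L}\<close>.\<close>
  define L where "L = n - 2"
  have L: "L \<ge> 3" "n = L + 2"
    using assms(2) by (auto simp: L_def)
  define A where "A = {..<L} \<union> {i, j}"
  have A01: "0 \<in> A" "1 \<in> A"
    using L by (auto simp: A_def)
  have pow_inj: "inj ((^) m)"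
    using assms(1) by (auto simp: inj_on_def)
  have M: "M = (^) m ` A"
    using L by (auto simp: assms(3) A_def)
  have cardA: "card A = L + 2"
    using assms(4) L(2) card_image[OF inj_on_subset[OF pow_inj subset_UNIV], of A] M by simp
  obtain S where SG: "S \<subseteq> carrier G"
    and split0: "\<forall>g \<in> carrier G - {\<one>\<^bsub>G\<^esub>}. \<exists>!p. p \<in> M \<times> S \<and> g = snd p [^]\<^bsub>G\<^esub> fst p"
    and nz0: "\<not> (\<exists>k \<in> M. \<exists>s \<in> S. \<one>\<^bsub>G\<^esub> = s [^]\<^bsub>G\<^esub> k)"
    using assms(8) unfolding set_splits_group_def by (elim exE conjE)
  have split: "\<exists>!p. p \<in> M \<times> S \<and> g = snd p [^]\<^bsub>G\<^esub> fst p" if "g \<in> carrier G - {\<one>\<^bsub>G\<^esub>}" for g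
    using split0 that by (rule bspec)
  have nz: "s [^]\<^bsub>G\<^esub> k \<noteq> \<one>\<^bsub>G\<^esub>" if "k \<in> M" "s \<in> S" for k s
    using nz0 that by metis
  have ex: "\<exists>a\<in>A. \<exists>s\<in>S. g = s [^]\<^bsub>G\<^esub> (m ^ a)" if g: "g \<in> carrier G - {\<one>\<^bsub>G\<^esub>}" for g
  proof -
    obtain p where p: "p \<in> M \<times> S" "g = snd p [^]\<^bsub>G\<^esub> fst p"
      using split[OF g] by (elim ex1E conjE)
    then obtain a where "a \<in> A" "fst p = m ^ a"
      unfolding M by auto
    with p show ?thesis
      by (metis mem_Times_iff)
  qed
  have uniq: "a = b \<and> s = t"
    if "s [^]\<^bsub>G\<^esub> (m ^ a) = t [^]\<^bsub>G\<^esub> (m ^ b)" "a \<in> A" "b \<in> A" "s \<in> S" "t \<in> S" for a b s t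
  proof -
    have "s [^]\<^bsub>G\<^esub> (m ^ a) \<in> carrier G - {\<one>\<^bsub>G\<^esub>}"
      using nz[of "m ^ a" s] that SG M by auto
    then obtain p where
      p: "\<And>q. q \<in> M \<times> S \<Longrightarrow> s [^]\<^bsub>G\<^esub> (m ^ a) = snd q [^]\<^bsub>G\<^esub> fst q \<Longrightarrow> q = p"
      using split by (metis (no_types, lifting))
    have "(m ^ a, s) = (m ^ b, t)"
      using p[of "(m ^ a, s)"] p[of "(m ^ b, t)"] that M by simp
    with pow_inj show ?thesis by (auto simp: inj_on_def)
  qed
  define X where "X = carrier G - {\<one>\<^bsub>G\<^esub>}"
  define f where "f = (\<lambda>x. x [^]\<^bsub>G\<^esub> m)"
  have mM: "m \<in> M" "1 \<in> M"
    using A01 unfolding M by (force, force)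
  have kernel: "x = \<one>\<^bsub>G\<^esub>" if "x \<in> carrier G" "x [^]\<^bsub>G\<^esub> m = \<one>\<^bsub>G\<^esub>" for x
  proof (rule splitting_imp_kernel_trivial[OF assms(5,6) SG ex _ _ that])
    show "inj_on (\<lambda>s. s [^]\<^bsub>G\<^esub> m) S"
      using uniq[of _ 1 _ 1] A01 by (intro inj_onI) auto
  qed (use nz mM in auto)
  have "inj_on f (carrier G)"
  proof (rule inj_onI)
    fix x y assume xy: "x \<in> carrier G" "y \<in> carrier G" "f x = f y"
    then have "(x \<otimes>\<^bsub>G\<^esub> inv\<^bsub>G\<^esub> y) [^]\<^bsub>G\<^esub> m = \<one>\<^bsub>G\<^esub>"
      by (simp add: f_def int_pow_mult_distrib m_comm int_pow_inv)
    with xy show "x = y"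
      using kernel[of "x \<otimes>\<^bsub>G\<^esub> inv\<^bsub>G\<^esub> y"] by (simp add: inv_solve_right')
  qed
  moreover have "f ` X \<subseteq> X"
    using kernel by (auto simp: X_def f_def)
  ultimately have f: "bij_betw f X X"
    using assms(6) endo_inj_surj[of X f] inj_on_subset[of f "carrier G" X]
    by (auto simp: bij_betw_def X_def)
  have funpow: "(f ^^ k) x = x [^]\<^bsub>G\<^esub> (m ^ k)" if "x \<in> carrier G" for k x
    using that by (induction k) (auto simp: f_def int_pow_pow mult.commute)
  have SX: "S \<subseteq> X"
    using SG nz[OF mM(2)] unfolding X_def by force
  have "bij_betw (\<lambda>(a, s). (f ^^ a) s) (A \<times> S) X"
    unfolding bij_betw_def
  proof
    show "inj_on (\<lambda>(a, s). (f ^^ a) s) (A \<times> S)"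
      using uniq SG by (auto simp: inj_on_def funpow subset_iff)
    show "(\<lambda>(a, s). (f ^^ a) s) ` (A \<times> S) = X"
    proof
      show "(\<lambda>(a, s). (f ^^ a) s) ` (A \<times> S) \<subseteq> X"
        using nz SG M by (auto simp: X_def funpow subset_iff)
      show "X \<subseteq> (\<lambda>(a, s). (f ^^ a) s) ` (A \<times> S)"
      proof
        fix x assume "x \<in> X"
        then obtain a s where "a \<in> A" "s \<in> S" "x = s [^]\<^bsub>G\<^esub> (m ^ a)"
          using ex unfolding X_def by blast
        with SG show "x \<in> (\<lambda>(a, s). (f ^^ a) s) ` (A \<times> S)"
          by (intro image_eqI[of _ _ "(a, s)"]) (auto simp: funpow subset_iff)
      qed
    qed
  qed
  moreover have "finite X" "X \<noteq> {}"
    using assms(6,7) by (auto simp: X_def)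
  ultimately have inj: "inj_on (\<lambda>a. a mod n) A"
    using permutation_tiling_distinct_mod[of X f S L i j] f SX L cardA by (simp add: A_def)
  \<comment> \<open>Any coincidence would leave \<open>A\<close> with fewer than
    \<open>L + 2\<close> elements.\<close>
  have ij: "i \<noteq> j" "i \<ge> L" "j \<ge> L"
    using cardA by (auto simp: A_def insert_absorb card_insert_if split: if_splits)
  have ge: "k mod n \<ge> L" if k: "k \<in> {i, j}" for k
  proof (rule ccontr)
    assume "\<not> k mod n \<ge> L"
    \<comment> \<open>A residue below \<open>L\<close> is itself an exponent in \<open>A\<close>
      congruent to \<open>k\<close>, so injectivity identifies the two.\<close>
    then have "k mod n = k"
      using k inj_onD[OF inj, of "k mod n" k] by (auto simp: A_def)
    with \<open>\<not> k mod n \<ge> L\<close> k ij show False by auto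
  qed
  have "i mod n \<noteq> j mod n"
    using inj_onD[OF inj, of i j] ij by (auto simp: A_def)
  moreover have "i mod n < n" "j mod n < n"
    using L by auto
  \<comment> \<open>Only the two residues \<open>n - 2\<close> and \<open>n - 1\<close> are left for
    \<open>i\<close> and \<open>j\<close>.\<close>
  moreover have "{p, q} = {L, L + 1}" if "p \<noteq> q" "p < n" "q < n" "L \<le> p" "L \<le> q" for p q
    using that L(2) by (cases "p = L") auto
  ultimately have "{i mod n, j mod n} = {L, L + 1}"
    using ge[of i] ge[of j] by blast
  then have "int ` {i mod n, j mod n} = int ` {L, L + 1}"
    by simp
  then show ?thesis
    using L by (simp add: set_cong_def zmod_int)
qed

end
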